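(* Let $\delta\in(0,1]$ and set $s=\lceil \log_2(1/(4\delta))\rceil$. Suppose $N\geq\max\{(2s)^s,3^{73s}\}$ is a positive integer and that $A\subseteq \{1,\ldots,N\}$ satisfies $|A|\geq\delta N$. Then \[R_2(A-A)\geq 3^{-8}N^{1/(8s+8)}.\]
   Context: $A-A=\{a-a':a,a'\in A\}$. For $L\geq 1$, a finite increasing sequence of real numbers $a_1<\cdots<a_n$ (equivalently, a finite set of reals listed in increasing order) is called $L$-regular if there is a positive real number $X$ such that $X\leq a_{i+1}-a_i\leq LX$ for all $i=1,\ldots,n-1$. For a set $B$ of real numbers, $R_L(B)=\max\{|B'|:B'\subseteq B,\ B'\text{ is }L\text{-regular}\}$. *)

theory Defs
  imports Complex_Main
begin

definition diff_set :: "real set \<Rightarrow> real set" where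
  "diff_set A = {a - a' | a a'. a \<in> A \<and> a' \<in> A}"

definition regular_seq :: "real \<Rightarrow> real list \<Rightarrow> bool" where
  "regular_seq L xs \<longleftrightarrow> sorted_wrt (<) xs \<and>
     (\<exists>X>0. \<forall>i. Suc i < length xs \<longrightarrow> X \<le> xs ! Suc i - xs ! i \<and> xs ! Suc i - xs ! i \<le> L * X)"

definition regular_set :: "real \<Rightarrow> real set \<Rightarrow> bool" where
  "regular_set L B \<longleftrightarrow> finite B \<and> regular_seq L (sorted_list_of_set B)"

(* The maximum exists whenever the cardinalities of the regular subsets of B are bounded,
   in particular for every finite B; otherwise Max is an unspecified value. *)
definition max_regular :: "real \<Rightarrow> real set \<Rightarrow> nat" where
  "max_regular L B = Max {card B' | B'. B' \<subseteq> B \<and> regular_set L B'}"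

end

theory Submission
  imports Defs
begin

text \<open>
  Cut an interval of \<open>K ^ Suc t\<close> integers into \<open>K\<close> blocks of length \<open>M = K ^ t\<close>. If \<open>A\<close> meets
  more than \<open>3 * K / 4\<close> of them, every index difference \<open>d \<le> K / 2\<close> is attained by two occupied
  blocks, so \<open>A - A\<close> has an element within \<open>M\<close> of \<open>d * M\<close>; using only \<open>d\<close> divisible by 6
  gives gaps between \<open>4 * M\<close> and \<open>8 * M\<close>. Otherwise some block has relative density at least
  \<open>4 / 3\<close> times that of \<open>A\<close>, and one passes to that block. As densities do not exceed 1, this
  stops within \<open>t\<close> rounds when the density exceeds \<open>(3 / 4) ^ t\<close>. For density at least
  \<open>2 powr (- s - 2)\<close> one may take \<open>t = 8 * s + 8\<close> and \<open>K\<close> about \<open>N powr (1 / t)\<close>, giving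
  \<open>K / 12\<close> terms.
\<close>

section \<open>Pigeonhole principles\<close>

text \<open>The fibres of \<open>f\<close> partition \<open>A\<close>, so the largest one has at
  least average size; multiplying out keeps the bound in the naturals.\<close>

lemma ex_large_fibre:
  assumes "finite A" "A \<noteq> {}"
  shows "\<exists>i\<in>f ` A. card A \<le> card (f ` A) * card {a \<in> A. f a = i}"
proof (rule ccontr)
  assume "\<not> ?thesis"
  then have small: "card (f ` A) * card {a \<in> A. f a = i} < card A" if "i \<in> f ` A" for i
    using that by force
  have "card A = (\<Sum>i\<in>f ` A. card {a \<in> A. f a = i})"
    using sum.image_gen[OF assms(1), of "\<lambda>_. 1::nat" f] by simp
  then have "card (f ` A) * card A = (\<Sum>i\<in>f ` A. card (f ` A) * card {a \<in> A. f a = i})"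
    by (simp add: sum_distrib_left)
  also have "\<dots> < (\<Sum>i\<in>f ` A. card A)"
    using assms small by (intro sum_strict_mono) auto
  finally show False by simp
qed

text \<open>Both \<open>I\<close> and its translate by \<open>d\<close> lie in
  \<open>{..<K + d}\<close>, which is too small for them to be disjoint.\<close>

lemma ex_difference:
  fixes I :: "nat set"
  assumes "I \<subseteq> {..<K}" "K + d < 2 * card I"
  shows "\<exists>i\<in>I. i + d \<in> I"
proof (rule ccontr)
  assume "\<not> ?thesis"
  then have disj: "I \<inter> (\<lambda>i. i + d) ` I = {}" by auto
  have fin: "finite I" using assms(1) finite_subset by blast
  have "card (I \<union> (\<lambda>i. i + d) ` I) = 2 * card I"
    using card_Un_disjoint[OF fin _ disj] fin by (simp add: card_image inj_on_def)
  moreover have "card (I \<union> (\<lambda>i. i + d) ` I) \<le> card {..<K + d}"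
    using assms(1) by (intro card_mono) auto
  ultimately show False using assms(2) by simp
qed

section \<open>Density increment\<close>

text \<open>The scale \<open>M\<close> is the block length in the round where the increment stops,
  so it depends on \<open>A\<close>.\<close>

lemma approximate_multiples_in_differences:
  fixes A :: "nat set"
  assumes "K > 0" "A \<subseteq> {c..<c + K ^ t}" "(3 / 4) ^ t * real (K ^ t) < real (card A)"
  shows "\<exists>M>0::nat. \<forall>d. 2 * d \<le> K \<longrightarrow>
    (\<exists>a\<in>A. \<exists>a'\<in>A. \<bar>real a' - real a - real d * real M\<bar> < real M)"
  using assms(2,3)
proof (induction t arbitrary: A c)
  case 0
  \<comment> \<open>Here the density would exceed 1 in an interval with a single integer.\<close>
  then have "card A \<le> card {c..<c + 1}" by (intro card_mono) auto
  with 0 show ?case by simp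
next
  case (Suc t)
  define M where "M = K ^ t"
  have M: "M > 0" using assms(1) by (simp add: M_def)
  define f where "f = (\<lambda>a. (a - c) div M)"
  have range: "c + f a * M \<le> a" "a < c + f a * M + M" if "a \<in> A" for a
  proof -
    have "c \<le> a" using that Suc.prems(1) by auto
    moreover have "f a * M \<le> a - c" by (simp add: f_def)
    moreover have "a - c < f a * M + M"
      using dividend_less_div_times[OF M, of "a - c"] by (simp add: f_def)
    ultimately show "c + f a * M \<le> a" "a < c + f a * M + M" by linarith+
  qed
  have I: "f ` A \<subseteq> {..<K}"
  proof
    fix i assume "i \<in> f ` A"
    then obtain a where a: "a \<in> A" "i = f a" by auto
    have "a < c + K * M" using a Suc.prems(1) by (auto simp: M_def)
    then have "f a * M < K * M" using range(1)[OF a(1)] by linarith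
    then show "i \<in> {..<K}" using a by simp
  qed
  have finA: "finite A" using Suc.prems(1) finite_subset by blast
  show ?case
  proof (cases "3 * K < 4 * card (f ` A)")
    case True
    show ?thesis
    proof (intro exI[of _ M] conjI M allI impI)
      fix d assume d: "2 * d \<le> K"
      have "K + d < 2 * card (f ` A)" using True d by linarith
      then obtain a a' where a: "a \<in> A" "a' \<in> A" "f a + d = f a'"
        using ex_difference[OF I] by (metis imageE)
      have "\<bar>real a' - real a - real d * real M\<bar> < real M"
      proof -
        \<comment> \<open>The offsets of \<open>a\<close> and \<open>a'\<close> within their blocks
          both lie in \<open>[0, M)\<close>, so they differ by less than \<open>M\<close>.\<close>
        have "real c + real (f a) * real M \<le> real a" "real a < real c + real (f a) * real M + real M"
          using range[OF a(1)] unfolding of_nat_add[symmetric] of_nat_mult[symmetric] by linarith+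
        moreover have "real c + real (f a') * real M \<le> real a'"
            "real a' < real c + real (f a') * real M + real M"
          using range[OF a(2)] unfolding of_nat_add[symmetric] of_nat_mult[symmetric] by linarith+
        moreover have "real (f a') * real M = real (f a) * real M + real d * real M"
          using a(3) by (metis of_nat_add distrib_right)
        ultimately show ?thesis by linarith
      qed
      then show "\<exists>a\<in>A. \<exists>a'\<in>A. \<bar>real a' - real a - real d * real M\<bar> < real M"
        using a by blast
    qed
  next
    case False
    have "0 < real (card A)" by (rule le_less_trans[OF _ Suc.prems(2)]) simp
    then have "A \<noteq> {}" by auto
    \<comment> \<open>At most \<open>3 * K / 4\<close> blocks are occupied, so the fullest one holds
      at least \<open>card A / (3 * K / 4)\<close> points; this cancels exactly one factor
      \<open>3 / 4 * K\<close> of the threshold.\<close>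
    then obtain i where i: "card A \<le> card (f ` A) * card {a \<in> A. f a = i}"
      using ex_large_fibre[OF finA, of f] by blast
    define B where "B = {a \<in> A. f a = i}"
    have sub: "B \<subseteq> {c + i * M..<c + i * M + K ^ t}"
      using range by (auto simp: B_def M_def)
    have "real (card A) \<le> real (card (f ` A)) * real (card B)"
      using i unfolding B_def of_nat_mult[symmetric] by linarith
    also have "\<dots> \<le> (3 / 4 * real K) * real (card B)"
      using False by (intro mult_right_mono) linarith+
    finally have "(3 / 4 * real K) * ((3 / 4) ^ t * real (K ^ t)) < (3 / 4 * real K) * real (card B)"
      using Suc.prems(2) by (simp add: mult_ac)
    then have "(3 / 4) ^ t * real (K ^ t) < real (card B)"
      using assms(1) by (subst (asm) mult_less_cancel_left_pos) auto
    from Suc.IH[OF sub this] show ?thesis unfolding B_def by blast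
  qed
qed

section \<open>Regular subsets of difference sets\<close>

lemma regular_set_image:
  assumes "X > 0" and gaps: "\<And>i. Suc i < n \<Longrightarrow> X \<le> y (Suc i) - y i \<and> y (Suc i) - y i \<le> L * X"
  shows "regular_set L (y ` {..<n})" and "card (y ` {..<n}) = n"
proof -
  have mono: "y i < y j" if "i < j" "j < n" for i j
    using that
  proof (induction j)
    case (Suc j)
    then have "y i \<le> y j" by (cases "i = j") auto
    then show ?case using gaps[of j] Suc.prems assms(1) by linarith
  qed simp
  have sorted: "sorted_wrt (<) (map y [0..<n])"
    using mono by (auto simp: sorted_wrt_iff_nth_less)
  then have list: "sorted_list_of_set (y ` {..<n}) = map y [0..<n]"
    using sorted_list_of_set.idem_if_sorted_distinct[of "map y [0..<n]"]
    by (simp add: strict_sorted_iff atLeast0LessThan)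
  then show "regular_set L (y ` {..<n})"
    using sorted gaps assms(1) by (auto simp: regular_set_def regular_seq_def)
  show "card (y ` {..<n}) = n"
    using arg_cong[OF list, of length] by simp
qed

text \<open>Finiteness of \<open>B\<close> makes the \<open>Max\<close> in the definition a genuine
  maximum.\<close>

lemma card_le_max_regular:
  assumes "finite B" "B' \<subseteq> B" "regular_set L B'"
  shows "card B' \<le> max_regular L B"
proof -
  have "finite {card B' | B'. B' \<subseteq> B \<and> regular_set L B'}"
    by (rule finite_subset[of _ "card ` Pow B"]) (use assms(1) in auto)
  then show ?thesis unfolding max_regular_def using assms(2,3) by (intro Max_ge) auto
qed

lemma finite_diff_set: "finite A \<Longrightarrow> finite (diff_set A)"
  unfolding diff_set_def by (rule finite_subset[of _ "(\<lambda>(x, y). x - y) ` (A \<times> A)"]) auto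

lemma max_regular_diff_set_pos:
  assumes "finite A" "A \<noteq> {}"
  shows "1 \<le> max_regular L (diff_set A)"
proof -
  have "{0} \<subseteq> diff_set A" using assms(2) by (auto simp: diff_set_def)
  moreover have "regular_set L {0}"
    by (auto simp: regular_set_def regular_seq_def intro: exI[of _ 1])
  ultimately show ?thesis
    using card_le_max_regular[OF finite_diff_set[OF assms(1)], of "{0}"] by simp
qed

text \<open>Errors below \<open>M\<close> at both ends turn the spacing \<open>6 * M\<close> into
  gaps between \<open>4 * M\<close> and \<open>8 * M\<close>, whose ratio is 2.\<close>

lemma max_regular_diff_set_ge:
  fixes A :: "nat set"
  assumes "finite A" "M > 0"
    and approx: "\<And>d. 2 * d \<le> K \<Longrightarrow>
      \<exists>a\<in>A. \<exists>a'\<in>A. \<bar>real a' - real a - real d * M\<bar> < M"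
  shows "(real K + 1) / 12 \<le> real (max_regular 2 (diff_set (real ` A)))"
proof -
  \<comment> \<open>\<open>k \<le> K div 12\<close> ensures \<open>2 * (6 * k) \<le> K\<close>.
    Counting \<open>k = 0\<close> as well yields \<open>K + 1\<close> instead of \<open>K\<close> in
    the bound, which later absorbs a floor.\<close>
  define n where "n = Suc (K div 12)"
  have "\<forall>k. \<exists>y. k < n \<longrightarrow> y \<in> diff_set (real ` A) \<and> \<bar>y - real (6 * k) * M\<bar> < M"
  proof
    fix k
    show "\<exists>y. k < n \<longrightarrow> y \<in> diff_set (real ` A) \<and> \<bar>y - real (6 * k) * M\<bar> < M"
    proof (cases "k < n")
      case True
      then have "2 * (6 * k) \<le> K" unfolding n_def by linarith
      from approx[OF this] show ?thesis by (fastforce simp: diff_set_def)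
    qed simp
  qed
  then obtain y where y: "\<And>k. k < n \<Longrightarrow> y k \<in> diff_set (real ` A)"
      "\<And>k. k < n \<Longrightarrow> \<bar>y k - real (6 * k) * M\<bar> < M"
    by metis
  have gaps: "4 * M \<le> y (Suc i) - y i \<and> y (Suc i) - y i \<le> 2 * (4 * M)" if "Suc i < n" for i
  proof -
    have "real (6 * Suc i) * M = real (6 * i) * M + 6 * M" by (simp add: algebra_simps)
    then show ?thesis using y(2)[of i] y(2)[of "Suc i"] that by linarith
  qed
  have "card (y ` {..<n}) \<le> max_regular 2 (diff_set (real ` A))"
    using y(1) assms(1,2) regular_set_image(1)[of "4 * M" n y 2] gaps
    by (intro card_le_max_regular finite_diff_set) auto
  then have "n \<le> max_regular 2 (diff_set (real ` A))"
    using regular_set_image(2)[of "4 * M" n y 2] gaps assms(2) by simp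
  moreover have "K + 1 \<le> 12 * n" unfolding n_def by presburger
  ultimately have "K + 1 \<le> 12 * max_regular 2 (diff_set (real ` A))" by linarith
  then have "real (K + 1) \<le> real (12 * max_regular 2 (diff_set (real ` A)))"
    unfolding of_nat_le_iff .
  then show ?thesis by simp
qed

text \<open>\<open>N\<close> need not be a power of \<open>K\<close>: blocks of length
  \<open>K ^ t\<close> cover \<open>{1..N}\<close> with total length at most \<open>2 * N\<close>,
  which costs the factor 2 in the density.\<close>

lemma max_regular_diff_set_dense:
  fixes A :: "nat set"
  assumes "K > 0" "K ^ t \<le> N" "A \<subseteq> {1..N}" "2 * (3 / 4) ^ t * real N < real (card A)"
  shows "(real K + 1) / 12 \<le> real (max_regular 2 (diff_set (real ` A)))"
proof -
  define M where "M = K ^ t"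
  have M: "M > 0" using assms(1) by (simp add: M_def)
  have finA: "finite A" using assms(3) finite_subset by blast
  have "0 < real (card A)" by (rule le_less_trans[OF _ assms(4)]) simp
  then have "A \<noteq> {}" by auto
  then obtain i where
    i: "card A \<le> card ((\<lambda>a. a div M) ` A) * card {a \<in> A. a div M = i}"
    using ex_large_fibre[OF finA, of "\<lambda>a. a div M"] by blast
  define B where "B = {a \<in> A. a div M = i}"
  have sub: "B \<subseteq> {i * M..<i * M + K ^ t}"
    using dividend_less_div_times[OF M] by (auto simp: B_def M_def add.commute)
  have "(\<lambda>a. a div M) ` A \<subseteq> {..N div M}" using assms(3) by (auto simp: div_le_mono)
  then have "card ((\<lambda>a. a div M) ` A) \<le> N div M + 1"
    using card_mono[of "{..N div M}"] by fastforce
  then have "card ((\<lambda>a. a div M) ` A) * M \<le> (N div M + 1) * M" by (rule mult_right_mono) simp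
  also have "\<dots> \<le> 2 * N"
    using assms(2) by (simp add: M_def add_mult_distrib trans_le_add1 add_le_mono mult_2)
  finally have blocks: "card ((\<lambda>a. a div M) ` A) * M \<le> 2 * N" .
  have "real N * (2 * ((3 / 4) ^ t * real M)) = (2 * (3 / 4) ^ t * real N) * real M" by simp
  also have "\<dots> < real (card A) * real M"
    using assms(4) M by (intro mult_strict_right_mono) auto
  also have "\<dots> \<le> real (card ((\<lambda>a. a div M) ` A) * card B * M)"
    using i unfolding of_nat_mult[symmetric] of_nat_le_iff B_def by (intro mult_right_mono) auto
  also have "\<dots> = real (card ((\<lambda>a. a div M) ` A) * M * card B)" by (simp add: mult_ac)
  also have "\<dots> \<le> real (2 * N * card B)"
    using blocks unfolding of_nat_le_iff by (intro mult_right_mono) auto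
  finally have "real N * (2 * ((3 / 4) ^ t * real M)) < real N * (2 * real (card B))"
    by (simp add: mult_ac)
  then have "(3 / 4) ^ t * real (K ^ t) < real (card B)"
    by (simp add: M_def mult_less_cancel_left)
  from approximate_multiples_in_differences[OF assms(1) sub this]
  obtain M' :: nat where "M' > 0"
    "\<forall>d. 2 * d \<le> K \<longrightarrow> (\<exists>a\<in>B. \<exists>a'\<in>B. \<bar>real a' - real a - real d * real M'\<bar> < real M')"
    by blast
  then show ?thesis
    using finA by (intro max_regular_diff_set_ge[of _ "real M'"]) (auto simp: B_def, blast)
qed

theorem theorem3:
  fixes \<delta> :: real and s :: int and N :: nat and A :: "nat set"
  assumes "0 < \<delta>" and "\<delta> \<le> 1"
    and "s = \<lceil>log 2 (1 / (4 * \<delta>))\<rceil>"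
    and "N > 0"
    and "real N \<ge> max ((2 * real_of_int s) powi s) (3 powi (73 * s))"
    and "A \<subseteq> {1..N}"
    and "real (card A) \<ge> \<delta> * real N"
  shows "real (max_regular 2 (diff_set (real ` A)))
           \<ge> 3 powi (-8) * real N powr (1 / (8 * real_of_int s + 8))"
proof (cases "s < 0")
  case True
  have "0 < real (card A)" by (rule less_le_trans[OF _ assms(7)]) (use assms(1,4) in simp)
  then have "finite A" "A \<noteq> {}" by (auto simp: card_gt_0_iff)
  then have "1 \<le> max_regular 2 (diff_set (real ` A))" by (intro max_regular_diff_set_pos) auto
  \<comment> \<open>The exponent is at most 0; for \<open>s = -1\<close> it is
    \<open>1 / 0 = 0\<close>. A one-point regular set therefore suffices.\<close>
  moreover have "real N powr (1 / (8 * real_of_int s + 8)) \<le> real N powr 0"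
    using True assms(4) by (intro powr_mono) (auto simp: divide_le_0_iff)
  moreover have "real N powr 0 = 1" using assms(4) by simp
  moreover have "(3::real) powi (-8) = 1 / 6561" by (simp add: power_int_minus field_simps)
  ultimately show ?thesis by simp
next
  case False
  define n where "n = nat s"
  define t where "t = 8 * n + 8"
  have s: "real_of_int s = real n" using False by (simp add: n_def)
  define x where "x = real N powr (1 / real t)"
  \<comment> \<open>Rounding the \<open>t\<close>-th root of \<open>N\<close> down gives
    \<open>K ^ t \<le> N\<close>, while \<open>x < K + 1\<close> keeps the loss small.\<close>
  define K where "K = nat \<lfloor>x\<rfloor>"
  have "1 \<le> x" using assms(4) by (simp add: x_def ge_one_powr_ge_zero)
  then have K: "K > 0" "real K \<le> x" "x < real K + 1" by (auto simp: K_def)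
  have "real (K ^ t) \<le> x ^ t" using K by (simp add: power_mono)
  also have "x ^ t = real N"
    using assms(4) by (simp add: x_def powr_power t_def)
  finally have KN: "K ^ t \<le> N" by simp
  have "log 2 (1 / (4 * \<delta>)) \<le> real n" using assms(3) s by linarith
  then have "1 / (4 * \<delta>) \<le> 2 powr real n" using assms(1) by (simp add: log_le_iff)
  then have "1 \<le> 4 * \<delta> * 2 ^ n" using assms(1) by (simp add: powr_realpow field_simps)
  then have \<delta>: "1 / (4 * 2 ^ n) \<le> \<delta>" by (simp add: field_simps)
  \<comment> \<open>The 8 in \<open>t\<close> comes from \<open>(3 / 4) ^ 8 < 1 / 8\<close>: one
    factor \<open>1 / 8\<close> covers the constants 2 and 4, and the other \<open>n\<close> factors
    are each below \<open>1 / 2\<close>.\<close>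
  have "(3 / 4 :: real) ^ t = ((3 / 4) ^ 8) ^ Suc n"
    unfolding power_mult[symmetric] by (simp add: t_def add.commute)
  also have "\<dots> < (1 / 8) ^ Suc n" by (intro power_strict_mono) (auto simp: power_divide)
  also have "\<dots> \<le> 1 / 8 * (1 / 2) ^ n" by (simp add: power_mono)
  finally have "2 * (3 / 4) ^ t < \<delta>" using \<delta> by (simp add: power_divide)
  then have "2 * (3 / 4) ^ t * real N < \<delta> * real N" using assms(4) by simp
  then have "(real K + 1) / 12 \<le> real (max_regular 2 (diff_set (real ` A)))"
    using assms(7) by (intro max_regular_diff_set_dense[OF K(1) KN assms(6)]) simp
  moreover have "(3::real) powi (-8) = 1 / 6561" by (simp add: power_int_minus field_simps)
  moreover have "real N powr (1 / (8 * real_of_int s + 8)) = x" by (simp add: x_def t_def s)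
  \<comment> \<open>The lower bound exceeds \<open>x / 12\<close>, and \<open>1 / 12\<close> is
    larger than \<open>1 / 6561\<close>.\<close>
  ultimately show ?thesis using K \<open>1 \<le> x\<close> by simp
qed

end
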